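(* Let $k\ge1$, $l\in\mathbb Z_{\ge0}$ and $\mathbf n=(n_1,\dots,n_k)\in\mathbb Z_{\ge0}^k$. Then, as power series in $u$, $$\mathrm{PS}_u\, Z^{(k)}_{l;\mathbf n}(u,1,\dots,1)^{[1]}=\mathrm{PS}_u\, Z^{(k)}_{l;\mathbf n}(u,1,\dots,1).$$
   Context: With formal variables $\mathbf u=(u;u_1,u_2,\dots)$, $$Z^{(k)}_{l;\mathbf n}(\mathbf u)=\sum_{\mathbf m\in\mathbb Z_{\ge0}^k}u^q\prod_{i=1}^k\binom{m_i+q_i}{m_i}u_i^{q_i},\qquad q=l+\sum_{j=1}^kj(2m_j-n_j),\quad q_i=l+\sum_{j=1}^{k-i}j(2m_{i+j}-n_{i+j}),$$ with $\binom{m+p}{m}=\frac{(p+m)(p+m-1)\cdots(p+1)}{m!}$ for all $p\in\mathbb Z$. $Z^{(k)}_{l;\mathbf n}(\mathbf u)^{[1]}$ is the same sum restricted to those $\mathbf m$ with $q_i\ge0$ for all $i\ge1$. The notation $(u,1,\dots,1)$ means evaluation at $u_1=\cdots=u_k=1$. $\mathrm{PS}_u f$ denotes the power series part (non-negative powers of $u$) of a Laurent series $f$ in $u$. *)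

theory Defs
  imports
    "HOL-Library.FuncSet"
    "HOL-Library.Poly_Mapping"
    "HOL-Computational_Algebra.Formal_Laurent_Series"
begin

(* Laurent polynomials over the rationals in u_1, u_2, ...: the group ring of the exponent vectors. *)
type_synonym laurent_poly = "(nat \<Rightarrow>\<^sub>0 int) \<Rightarrow>\<^sub>0 rat"

(* The monomial c * u_i^a; a may be negative. *)
definition var_monom :: "rat \<Rightarrow> nat \<Rightarrow> int \<Rightarrow> laurent_poly" where
  "var_monom c i a = Poly_Mapping.single (Poly_Mapping.single i a) c"

(* The vectors m = (m_1, ..., m_k) of natural numbers, as functions extensional on {1..k}. *)
definition multi_idx :: "nat \<Rightarrow> (nat \<Rightarrow> nat) set" where
  "multi_idx k = {1..k} \<rightarrow>\<^sub>E UNIV"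

definition q_tot :: "nat \<Rightarrow> nat \<Rightarrow> (nat \<Rightarrow> nat) \<Rightarrow> (nat \<Rightarrow> nat) \<Rightarrow> int" where
  "q_tot k l n m = int l + (\<Sum>j=1..k. int j * (2 * int (m j) - int (n j)))"

definition q_idx :: "nat \<Rightarrow> nat \<Rightarrow> (nat \<Rightarrow> nat) \<Rightarrow> (nat \<Rightarrow> nat) \<Rightarrow> nat \<Rightarrow> int" where
  "q_idx k l n m i = int l + (\<Sum>j=1..k-i. int j * (2 * int (m (i + j)) - int (n (i + j))))"

(* Binomial coefficient (m + p choose m) = (p + m) (p + m - 1) ... (p + 1) / m! for every integer p;
   for p < 0 it need not vanish. *)
definition ext_binom :: "nat \<Rightarrow> int \<Rightarrow> rat" where
  "ext_binom m p = of_int (int m + p) gchoose m"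

definition Z_term :: "nat \<Rightarrow> nat \<Rightarrow> (nat \<Rightarrow> nat) \<Rightarrow> (nat \<Rightarrow> nat) \<Rightarrow> laurent_poly" where
  "Z_term k l n m = (\<Prod>i=1..k. var_monom (ext_binom (m i) (q_idx k l n m i)) i (q_idx k l n m i))"

(* The sum over m in M of u^q * Z_term, as a formal Laurent series in u, given by its coefficients:
   only finitely many m have a given value of q, and q is bounded below
   (finite_q_fibre and Z_series_nth below). *)
definition Z_series ::
    "(nat \<Rightarrow> nat) set \<Rightarrow> nat \<Rightarrow> nat \<Rightarrow> (nat \<Rightarrow> nat) \<Rightarrow> laurent_poly fls" where
  "Z_series M k l n = Abs_fls (\<lambda>N. \<Sum>m | m \<in> M \<and> q_tot k l n m = N. Z_term k l n m)"

definition Z_full :: "nat \<Rightarrow> nat \<Rightarrow> (nat \<Rightarrow> nat) \<Rightarrow> laurent_poly fls" where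
  "Z_full k l n = Z_series (multi_idx k) k l n"

(* The restricted sum, written with a superscript [1]. *)
definition Z_restr :: "nat \<Rightarrow> nat \<Rightarrow> (nat \<Rightarrow> nat) \<Rightarrow> laurent_poly fls" where
  "Z_restr k l n = Z_series {m \<in> multi_idx k. \<forall>i\<in>{1..k}. q_idx k l n m i \<ge> 0} k l n"

definition eval_lpoly :: "(nat \<Rightarrow> rat) \<Rightarrow> laurent_poly \<Rightarrow> rat" where
  "eval_lpoly w p = (\<Sum>e\<in>Poly_Mapping.keys p. Poly_Mapping.lookup p e *
      (\<Prod>i\<in>Poly_Mapping.keys e. w i powi Poly_Mapping.lookup e i))"

(* Evaluation u_i = w i of all variables but u, coefficientwise. *)
definition eval_fls :: "(nat \<Rightarrow> rat) \<Rightarrow> laurent_poly fls \<Rightarrow> rat fls" where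
  "eval_fls w f = Abs_fls (\<lambda>N. eval_lpoly w (fls_nth f N))"

lemma q_tot_lower:
  "q_tot k l n m \<ge> int l - (\<Sum>j=1..k. int j * int (n j))"
proof -
  have "(\<Sum>j=1..k. - (int j * int (n j))) \<le> (\<Sum>j=1..k. int j * (2 * int (m j) - int (n j)))"
    by (intro sum_mono) (simp add: algebra_simps)
  then show ?thesis by (simp add: q_tot_def sum_negf)
qed

lemma finite_q_fibre: "finite {m \<in> multi_idx k. q_tot k l n m = N}"
proof -
  define B where "B = nat (N + (\<Sum>j=1..k. int j * int (n j)))"
  have "m j \<le> B" if m: "q_tot k l n m = N" and j: "j \<in> {1..k}" for m j
  proof -
    have "int (m j) \<le> 2 * int j * int (m j)"
      using j mult_right_mono[of 1 "2 * int j" "int (m j)"] by simp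
    also have "\<dots> \<le> (\<Sum>j=1..k. 2 * int j * int (m j))"
      using j by (intro member_le_sum) auto
    also have "\<dots> = N - int l + (\<Sum>j=1..k. int j * int (n j))"
      using m by (simp add: q_tot_def algebra_simps sum_subtractf flip: sum.distrib)
    finally show ?thesis unfolding B_def by linarith
  qed
  then have "{m \<in> multi_idx k. q_tot k l n m = N} \<subseteq> {1..k} \<rightarrow>\<^sub>E {..B}"
    unfolding multi_idx_def by (auto simp: PiE_iff extensional_def)
  then show ?thesis
    by (rule finite_subset) (intro finite_PiE; simp)
qed

lemma Z_series_nth:
  "fls_nth (Z_series M k l n) N = (\<Sum>m | m \<in> M \<and> q_tot k l n m = N. Z_term k l n m)"
  unfolding Z_series_def
proof (rule nth_Abs_fls_lower_bound, intro allI impI)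
  fix N assume "N < int l - (\<Sum>j=1..k. int j * int (n j))"
  then have "{m. m \<in> M \<and> q_tot k l n m = N} = {}"
    using q_tot_lower[where l = l and k = k and n = n] by (force simp: not_less[symmetric])
  then show "(\<Sum>m | m \<in> M \<and> q_tot k l n m = N. Z_term k l n m) = 0" by (simp only: sum.empty)
qed

lemma eval_fls_nth: "fls_nth (eval_fls w f) N = eval_lpoly w (fls_nth f N)"
  unfolding eval_fls_def
  by (rule nth_Abs_fls_lower_bound[of "fls_subdegree f"]) (simp add: eval_lpoly_def)

end

theory Submission
  imports Defs
begin

text \<open>
  Write \<open>q\<^sub>0 = q\<close>; then \<open>q\<^sub>i\<^sub>-\<^sub>1 = 2 q\<^sub>i - q\<^sub>i\<^sub>+\<^sub>1 + 2 m\<^sub>i - n\<^sub>i\<close>. Fix \<open>m\<^sub>i\<^sub>+\<^sub>1, \<dots>, m\<^sub>k\<close>, hence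
  \<open>q\<^sub>i\<close> and \<open>q\<^sub>i\<^sub>+\<^sub>1\<close>. Summing the binomial series successively over \<open>m\<^sub>1, \<dots>, m\<^sub>i\<close> and using the
  Q-system \<open>Q\<^sub>j\<^sub>+\<^sub>1 Q\<^sub>j\<^sub>-\<^sub>1 = Q\<^sub>j\<^sup>2 - 1\<close>, \<open>Q\<^sub>0 = 1\<close>, \<open>Q\<^sub>1 = u\<^sup>-\<^sup>1\<close>, one obtains a constant times
  \<open>Q\<^sub>1\<close> times the product of \<open>Q\<^sub>i\<^sub>+\<^sub>1\<close> to the power \<open>- q\<^sub>i - 1\<close>, of \<open>Q\<^sub>i\<close> to the power \<open>q\<^sub>i\<^sub>+\<^sub>1 + 1\<close>
  and of \<open>Q\<^sub>j\<close> to the power \<open>n\<^sub>j\<close> for \<open>j \<le> i\<close>. All \<open>Q\<^sub>j\<close> are polynomials in \<open>u\<^sup>-\<^sup>1\<close>, so if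
  \<open>q\<^sub>i < 0 \<le> q\<^sub>i\<^sub>+\<^sub>1\<close> then this is a polynomial in \<open>u\<^sup>-\<^sup>1\<close> divisible by \<open>Q\<^sub>1 = u\<^sup>-\<^sup>1\<close> and has no
  power series part. The terms with some negative \<open>q\<^sub>i\<close> are grouped by the largest such \<open>i\<close>
  (which is less than \<open>k\<close>, as \<open>q\<^sub>k = l\<close>) and by \<open>m\<^sub>i\<^sub>+\<^sub>1, \<dots>, m\<^sub>k\<close>.
\<close>

section \<open>Integer powers of invertible power series\<close>

lemma fps_to_fls_power_int:
  fixes f :: "'a::field fps"
  assumes "f $ 0 \<noteq> 0"
  shows "fps_to_fls (f powi a) = fps_to_fls f powi a"
  using assms
  by (simp add: power_int_def fps_to_fls_power fls_inverse_fps_to_fls subdegree_eq_0)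

lemma fps_binomial_compose_eq_power_int:
  fixes z :: "'a::field_char_0 fps"
  assumes z: "z $ 0 = 0"
  shows "fps_binomial (of_int c) oo z = (1 + z) powi c"
proof (cases "c \<ge> 0")
  case True
  then have "fps_binomial (of_int c) = (1 + fps_X :: 'a fps) ^ nat c"
    by (simp flip: fps_binomial_of_nat)
  then show ?thesis
    using True z
    by (simp add: power_int_def fps_compose_add_distrib flip: fps_compose_power)
next
  case False
  then have "fps_binomial (of_int c) = inverse ((1 + fps_X :: 'a fps) ^ nat (- c))"
    by (simp flip: fps_binomial_minus_of_nat)
  then show ?thesis
    using False z
    by (simp add: power_int_def fps_inverse_compose fps_inverse_power fps_compose_add_distrib
        flip: fps_compose_power)
qed

text \<open>Upper negation, valid for every integer \<open>p\<close>; it makes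
  \<open>(1 - y) powi (- p - 1)\<close> the generating function of these binomials.\<close>

lemma ext_binom_eq: "ext_binom m p = (- 1) ^ m * (of_int (- p - 1) gchoose m)"
  unfolding ext_binom_def by (subst gbinomial_negated_upper) simp

text \<open>As \<open>y\<close> has no constant term, \<open>y ^ a\<close> reaches coefficient
  \<open>N\<close> only for \<open>a \<le> N\<close>, so the truncation loses nothing of the
  binomial series.\<close>

lemma sum_ext_binom_power:
  fixes y :: "rat fps"
  assumes y: "y $ 0 = 0"
  shows "(\<Sum>a\<le>N. ext_binom a p * (W * y ^ a) $ N) = (W * (1 - y) powi (- p - 1)) $ N"
proof -
  have minus_power: "((- y) ^ a) $ j = (- 1) ^ a * y ^ a $ j" for a j
    by (cases "even a") simp_all
  have "(1 - y) powi (- p - 1) = fps_binomial (of_int (- p - 1)) oo (- y)"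
    using fps_binomial_compose_eq_power_int[of "- y" "- p - 1"] y by simp
  then have coeff: "((1 - y) powi (- p - 1)) $ j = (\<Sum>a\<le>N. ext_binom a p * y ^ a $ j)" if "j \<le> N" for j
  proof -
    have "((1 - y) powi (- p - 1)) $ j = (\<Sum>a\<in>{0..j}. ext_binom a p * y ^ a $ j)"
      using \<open>(1 - y) powi (- p - 1) = _\<close>
      by (simp add: fps_compose_nth ext_binom_eq minus_power mult_ac)
    also have "\<dots> = (\<Sum>a\<le>N. ext_binom a p * y ^ a $ j)"
      using that y startsby_zero_power_prefix[of y] by (intro sum.mono_neutral_left) auto
    finally show ?thesis .
  qed
  have "(\<Sum>a\<le>N. ext_binom a p * (W * y ^ a) $ N)
      = (\<Sum>a\<le>N. \<Sum>j=0..N. W $ j * (ext_binom a p * y ^ a $ (N - j)))"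
    by (simp add: fps_mult_nth sum_distrib_left mult_ac)
  also have "\<dots> = (\<Sum>j=0..N. W $ j * (\<Sum>a\<le>N. ext_binom a p * y ^ a $ (N - j)))"
    by (subst sum.swap) (simp add: sum_distrib_left)
  also have "\<dots> = (W * (1 - y) powi (- p - 1)) $ N"
    by (simp add: fps_mult_nth coeff)
  finally show ?thesis .
qed

section \<open>Chebyshev polynomials\<close>

text \<open>With \<open>x = u\<^sup>2\<close>, \<open>u\<^sup>-\<^sup>j cheb j\<close> is \<open>Q\<^sub>j\<close>.\<close>
fun cheb :: "nat \<Rightarrow> rat fps" where
  "cheb 0 = 1"
| "cheb (Suc 0) = 1"
| "cheb (Suc (Suc j)) = cheb (Suc j) - fps_X * cheb j"

lemma cheb_nth_0 [simp]: "cheb j $ 0 = 1"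
  by (induction j rule: cheb.induct) auto

text \<open>The Q-system after rescaling. By the recursion, the defect
  \<open>cheb (Suc (Suc j)) * cheb j - cheb (Suc j) ^ 2\<close> is multiplied by
  \<open>fps_X\<close> when \<open>j\<close> grows by one.\<close>

lemma cheb_quadratic: "cheb (Suc (Suc j)) * cheb j = cheb (Suc j) ^ 2 - fps_X ^ Suc j"
proof (induction j)
  case (Suc j)
  have "cheb (Suc (Suc (Suc j))) * cheb (Suc j) - cheb (Suc (Suc j)) ^ 2
      = - fps_X * (cheb (Suc j) ^ 2 - cheb (Suc (Suc j)) * cheb j)"
    by (simp add: algebra_simps power2_eq_square)
  also have "\<dots> = - (fps_X ^ Suc (Suc j))"
    unfolding Suc by simp
  finally show ?case
    by (simp add: algebra_simps del: cheb.simps)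
qed simp

text \<open>The degree is doubled since \<open>x = u\<^sup>2\<close>.\<close>
definition fps_deg_le :: "'a::zero fps \<Rightarrow> int \<Rightarrow> bool" where
  "fps_deg_le f d \<longleftrightarrow> (\<forall>N. d < 2 * int N \<longrightarrow> f $ N = 0)"

lemma fps_deg_le_1: "fps_deg_le 1 0"
  by (simp add: fps_deg_le_def)

lemma fps_deg_le_mult:
  fixes f g :: "'a::comm_ring_1 fps"
  assumes "fps_deg_le f d" "fps_deg_le g e"
  shows "fps_deg_le (f * g) (d + e)"
  unfolding fps_deg_le_def
proof (intro allI impI)
  fix N
  assume N: "d + e < 2 * int N"
  have "f $ j * g $ (N - j) = 0" if "j \<le> N" for j
  proof (cases "d < 2 * int j")
    case False
    then have "e < 2 * int (N - j)"
      using N that by (simp add: of_nat_diff)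
    then show ?thesis
      using assms by (simp add: fps_deg_le_def)
  qed (use assms in \<open>simp add: fps_deg_le_def\<close>)
  then show "(f * g) $ N = 0"
    by (simp add: fps_mult_nth)
qed

lemma fps_deg_le_power:
  fixes f :: "'a::comm_ring_1 fps"
  assumes "fps_deg_le f d"
  shows "fps_deg_le (f ^ a) (int a * d)"
proof (induction a)
  case (Suc a)
  then show ?case
    using fps_deg_le_mult[OF assms Suc] by (simp add: algebra_simps)
qed (simp add: fps_deg_le_1)

lemma fps_deg_le_power_int:
  fixes f :: "'a::field fps"
  assumes "fps_deg_le f d" "a \<ge> 0"
  shows "fps_deg_le (f powi a) (a * d)"
  using fps_deg_le_power[OF assms(1), of "nat a"] assms(2) by (simp add: power_int_def)

lemma fps_deg_le_prod:
  fixes f :: "'b \<Rightarrow> 'a::comm_ring_1 fps"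
  assumes "\<And>x. x \<in> A \<Longrightarrow> fps_deg_le (f x) (d x)"
  shows "fps_deg_le (prod f A) (sum d A)"
  using assms
  by (induction A rule: infinite_finite_induct) (simp_all add: fps_deg_le_1 fps_deg_le_mult)

text \<open>This bound is what makes u^(-j) \<open>cheb j\<close> a polynomial in 1/u.\<close>

lemma cheb_deg_le: "fps_deg_le (cheb j) (int j)"
proof (induction j rule: cheb.induct)
  case (3 j)
  have "fps_deg_le (fps_X * cheb j) (2 + int j)"
    using "3.IH"(2) by (intro fps_deg_le_mult) (auto simp: fps_deg_le_def fps_X_def)
  then show ?case
    using "3.IH"(1) by (simp add: fps_deg_le_def)
qed (auto simp: fps_deg_le_def)

section \<open>Summing over the lower indices\<close>

text \<open>The closed form of the sum over \<open>m\<^sub>1, \<dots>, m\<^sub>i\<close> for \<open>q\<^sub>i = p\<close>, \<open>q\<^sub>i\<^sub>+\<^sub>1 = p'\<close>, up to a power of \<open>u\<close>.\<close>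
definition Q_factor :: "(nat \<Rightarrow> nat) \<Rightarrow> nat \<Rightarrow> int \<Rightarrow> int \<Rightarrow> rat fps" where
  "Q_factor n i p p' =
    cheb (Suc i) powi (- p - 1) * cheb i powi (p' + 1) * (\<Prod>j=1..i. cheb j ^ n j)"

lemma Q_factor_0 [simp]: "Q_factor n 0 p p' = 1"
  by (simp add: Q_factor_def power_int_def)

text \<open>The signs make both integer exponents nonnegative, so the product is a
  polynomial.\<close>

lemma Q_factor_deg_le:
  assumes "p < 0" "p' \<ge> - 1"
  shows "fps_deg_le (Q_factor n i p p')
    ((- p - 1) * int (Suc i) + (p' + 1) * int i + (\<Sum>j=1..i. int (n j) * int j))"
  unfolding Q_factor_def using assms
  by (intro fps_deg_le_mult fps_deg_le_prod fps_deg_le_power fps_deg_le_power_int cheb_deg_le) auto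

text \<open>Raising \<open>a\<close> by one lowers the exponent of \<open>cheb (Suc i)\<close> by 2
  and brings in \<open>fps_X ^ Suc i\<close>: a geometric progression with ratio \<open>y i\<close>.
  By the Q-system, \<open>1 - y i\<close> is \<open>cheb (Suc (Suc i)) * cheb i\<close> over the
  square of \<open>cheb (Suc i)\<close>, which yields the closed form for the next index.\<close>

lemma Q_factor_Suc:
  defines "y i \<equiv> fps_X ^ Suc i * cheb (Suc i) powi (- 2)"
  obtains W where
    "\<And>a. fps_X ^ (Suc i * a) * Q_factor n i (2 * p - p' + 2 * int a - int (n (Suc i))) p = W * y i ^ a"
    "Q_factor n (Suc i) p p' = W * (1 - y i) powi (- p - 1)"
proof -
  \<comment> \<open>Laurent series form a field, where integer powers of nonzero elements obey the
    usual laws; \<open>fps_to_fls\<close> is injective.\<close>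
  define A B C Z D where "A = fps_to_fls (cheb i)" and "B = fps_to_fls (cheb (Suc i))"
    and "C = fps_to_fls (cheb (Suc (Suc i)))" and "Z = fps_to_fls (fps_X ^ Suc i :: rat fps)"
    and "D = fps_to_fls (\<Prod>j=1..i. cheb j ^ n j)"
  \<comment> \<open>The left side of the progression at \<open>a = 0\<close>.\<close>
  define W where "W = cheb (Suc i) powi (p' - 2 * p + int (n (Suc i)) - 1) * cheb i powi (p + 1)
    * (\<Prod>j=1..i. cheb j ^ n j)"
  have nz: "cheb j \<noteq> 0" for j
    by (metis cheb_nth_0 fps_zero_nth zero_neq_one)
  then have [simp]: "A \<noteq> 0" "B \<noteq> 0" "C \<noteq> 0"
    by (simp_all add: A_def B_def C_def del: cheb.simps)
  have "fps_to_fls (cheb (Suc (Suc i)) * cheb i) = fps_to_fls (cheb (Suc i) ^ 2 - fps_X ^ Suc i)"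
    by (simp only: cheb_quadratic)
  then have quad: "C * A = B ^ 2 - Z"
    unfolding A_def B_def C_def Z_def
    by (simp only: fls_times_fps_to_fls fps_to_fls_minus fps_to_fls_power)
  have yL: "fps_to_fls (y i) = Z * B powi (- 2)"
    by (simp add: y_def Z_def B_def fls_times_fps_to_fls fps_to_fls_power_int)
  have WL: "fps_to_fls W = B powi (p' - 2 * p + int (n (Suc i)) - 1) * A powi (p + 1) * D"
    by (simp add: W_def A_def B_def D_def fls_times_fps_to_fls fps_to_fls_power_int)
  have "1 - Z * B powi (- 2) = (B ^ 2 - Z) * B powi (- 2)"
    by (simp add: field_simps power_int_minus)
  then have oneL: "fps_to_fls (1 - y i) = C * A * B powi (- 2)"
    by (simp add: yL quad)
  show thesis
  proof (rule that[of W])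
    fix a
    have "fps_to_fls (fps_X ^ (Suc i * a) * Q_factor n i (2 * p - p' + 2 * int a - int (n (Suc i))) p)
        = Z ^ a * (B powi (- (2 * p - p' + 2 * int a - int (n (Suc i))) - 1) * A powi (p + 1) * D)"
      by (simp add: Q_factor_def A_def B_def D_def Z_def fls_times_fps_to_fls fps_to_fls_power_int
          fps_to_fls_power power_mult del: power_Suc mult_Suc)
    also have "B powi (- (2 * p - p' + 2 * int a - int (n (Suc i))) - 1)
        = B powi (p' - 2 * p + int (n (Suc i)) - 1) * (B powi (- 2)) powi (int a)"
      by (subst power_int_mult[symmetric], subst power_int_add[symmetric]) (simp_all add: algebra_simps)
    also have "Z ^ a * (\<dots> * A powi (p + 1) * D) = fps_to_fls (W * y i ^ a)"
      by (simp add: fls_times_fps_to_fls WL fps_to_fls_power yL power_mult_distrib mult_ac)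
    finally show "fps_X ^ (Suc i * a) * Q_factor n i (2 * p - p' + 2 * int a - int (n (Suc i))) p
        = W * y i ^ a"
      by (simp only: fps_to_fls_eq_iff)
  next
    have y0: "(1 - y i) $ 0 \<noteq> 0"
      by (simp add: y_def)
    have "fps_to_fls (W * (1 - y i) powi (- p - 1))
        = B powi (p' - 2 * p + int (n (Suc i)) - 1) * A powi (p + 1) * D
          * (C powi (- p - 1) * A powi (- p - 1) * (B powi (- 2)) powi (- p - 1))"
      by (simp add: fls_times_fps_to_fls WL fps_to_fls_power_int[OF y0] oneL power_int_mult_distrib
          del: fps_to_fls_minus)
    also have "\<dots> = C powi (- p - 1) * (A powi (p + 1) * A powi (- p - 1)) * D
        * (B powi (p' - 2 * p + int (n (Suc i)) - 1) * B powi (2 * p + 2))"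
      by (simp add: mult_ac add.commute flip: power_int_mult)
    \<comment> \<open>The powers of \<open>cheb i\<close> from \<open>W\<close> and from
      \<open>1 - y i\<close> cancel.\<close>
    also have "A powi (p + 1) * A powi (- p - 1) = 1"
      by (simp flip: power_int_add)
    also have "B powi (p' - 2 * p + int (n (Suc i)) - 1) * B powi (2 * p + 2)
        = B powi (p' + 1) * B ^ n (Suc i)"
      by (simp add: algebra_simps flip: power_int_add power_int_of_nat)
    also have "C powi (- p - 1) * 1 * D * \<dots> = fps_to_fls (Q_factor n (Suc i) p p')"
      by (simp add: Q_factor_def B_def C_def D_def fls_times_fps_to_fls fps_to_fls_power_int
          fps_to_fls_power mult_ac del: cheb.simps)
    finally show "Q_factor n (Suc i) p p' = W * (1 - y i) powi (- p - 1)"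
      by (simp only: fps_to_fls_eq_iff)
  qed
qed

section \<open>Linear relations between the exponents\<close>

lemma q_idx_eq:
  "q_idx k l n m i = int l + (\<Sum>j\<in>{i<..k}. (int j - int i) * (2 * int (m j) - int (n j)))"
proof -
  have "(\<Sum>j=1..k-i. int j * (2 * int (m (i + j)) - int (n (i + j))))
      = (\<Sum>j\<in>{i<..k}. (int j - int i) * (2 * int (m j) - int (n j)))"
    by (rule sum.reindex_bij_witness[of _ "\<lambda>j. j - i" "\<lambda>j. i + j"]) (auto simp: of_nat_diff)
  then show ?thesis
    by (simp add: q_idx_def)
qed

lemma q_idx_cong:
  assumes "\<And>j. j \<in> {i<..k} \<Longrightarrow> m j = m' j"
  shows "q_idx k l n m i = q_idx k l n m' i"
  using assms by (simp add: q_idx_eq)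

lemma q_idx_top [simp]: "q_idx k l n m k = int l"
  by (simp add: q_idx_def)

text \<open>Since (i + 1)(j - i) - i(j - i - 1) = j, this combination isolates the share of the tail
  in q, as the degree comparison requires.\<close>

lemma q_idx_linear:
  "int (Suc i) * q_idx k l n m i - int i * q_idx k l n m (Suc i)
    = int l + (\<Sum>j\<in>{i<..k}. int j * (2 * int (m j) - int (n j)))"
proof -
  define d where "d j = 2 * int (m j) - int (n j)" for j
  \<comment> \<open>The added index \<open>j = Suc i\<close> has coefficient 0.\<close>
  have 1: "q_idx k l n m (Suc i) = int l + (\<Sum>j\<in>{i<..k}. (int j - int (Suc i)) * d j)"
    unfolding q_idx_eq d_def
    by (simp, intro sum.mono_neutral_left) auto
  have 2: "q_idx k l n m i = int l + (\<Sum>j\<in>{i<..k}. (int j - int i) * d j)"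
    unfolding q_idx_eq d_def ..
  have "int (Suc i) * q_idx k l n m i - int i * q_idx k l n m (Suc i)
      = int l + (\<Sum>j\<in>{i<..k}. int (Suc i) * ((int j - int i) * d j) - int i * ((int j - int (Suc i)) * d j))"
    unfolding 1 2 sum_subtractf sum_distrib_left[symmetric] by (simp add: algebra_simps)
  also have "\<dots> = int l + (\<Sum>j\<in>{i<..k}. int j * d j)"
    by (intro arg_cong2[of _ _ _ _ "(+)"] sum.cong refl) (simp add: algebra_simps)
  finally show ?thesis
    by (simp add: d_def)
qed

section \<open>Sums over index vectors with a common tail\<close>

definition weight :: "nat set \<Rightarrow> (nat \<Rightarrow> nat) \<Rightarrow> nat" where
  "weight J m = (\<Sum>j\<in>J. j * m j)"

text \<open>Fixing the weight fixes q, so a class collects terms with the same power of u.\<close>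

definition tail_class :: "nat \<Rightarrow> nat \<Rightarrow> (nat \<Rightarrow> nat) \<Rightarrow> nat \<Rightarrow> (nat \<Rightarrow> nat) set" where
  "tail_class k i m0 N =
    {m \<in> multi_idx k. (\<forall>j\<in>{i<..k}. m j = m0 j) \<and> weight {1..k} m = N}"

lemma finite_tail_class: "finite (tail_class k i m0 N)"
proof -
  have "m j \<le> N" if "weight {1..k} m = N" "j \<in> {1..k}" for m j
  proof -
    have "m j \<le> j * m j"
      using that by simp
    also have "\<dots> \<le> N"
      unfolding that(1)[symmetric] weight_def using that(2) by (intro member_le_sum) auto
    finally show ?thesis .
  qed
  then have "tail_class k i m0 N \<subseteq> {1..k} \<rightarrow>\<^sub>E {..N}"
    unfolding tail_class_def multi_idx_def by (auto simp: PiE_iff extensional_def)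
  then show ?thesis
    by (rule finite_subset) (intro finite_PiE; simp)
qed

lemma tail_class_Suc_slice:
  assumes "Suc i \<le> k"
  shows "{m \<in> tail_class k (Suc i) m0 N. m (Suc i) = a} = tail_class k i (m0(Suc i := a)) N"
proof -
  have "{i<..k} = insert (Suc i) {Suc i<..k}"
    using assms by auto
  then show ?thesis
    by (auto simp: tail_class_def)
qed

text \<open>As a function of i, max(j - i, 0) is linear but for a kink at i = j, so the second
  difference retains only the term \<open>j = Suc i\<close>.\<close>

lemma q_idx_second_difference:
  assumes "Suc i < k"
  shows "q_idx k l n m i = 2 * q_idx k l n m (Suc i) - q_idx k l n m (Suc (Suc i))
    + 2 * int (m (Suc i)) - int (n (Suc i))"
proof -
  define d where "d j = 2 * int (m j) - int (n j)" for j
  have "{i<..k} = insert (Suc i) {Suc i<..k}" and split: "{Suc i<..k} = insert (Suc (Suc i)) {Suc (Suc i)<..k}"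
    using assms by auto
  then have "q_idx k l n m i = int l + d (Suc i) + 2 * d (Suc (Suc i))
      + (\<Sum>j\<in>{Suc (Suc i)<..k}. (int j - int i) * d j)"
    by (simp add: q_idx_eq d_def)
  moreover have "q_idx k l n m (Suc i) = int l + d (Suc (Suc i))
      + (\<Sum>j\<in>{Suc (Suc i)<..k}. (int j - int i - 1) * d j)"
    unfolding q_idx_eq split by (simp add: d_def algebra_simps)
  moreover have "q_idx k l n m (Suc (Suc i)) = int l
      + (\<Sum>j\<in>{Suc (Suc i)<..k}. (int j - int i - 2) * d j)"
    unfolding q_idx_eq by (simp add: d_def algebra_simps)
  moreover have "(\<Sum>j\<in>{Suc (Suc i)<..k}. (int j - int i) * d j)
      = 2 * (\<Sum>j\<in>{Suc (Suc i)<..k}. (int j - int i - 1) * d j)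
        - (\<Sum>j\<in>{Suc (Suc i)<..k}. (int j - int i - 2) * d j)"
    unfolding sum_distrib_left sum_subtractf[symmetric] by (intro sum.cong) (simp_all add: algebra_simps)
  ultimately show ?thesis
    by (simp add: d_def)
qed

text \<open>Induction on \<open>i\<close>: slicing by the value \<open>a\<close> of
  \<open>m (Suc i)\<close> leaves classes for the smaller index, whose closed forms are geometric in
  \<open>a\<close>; the sum over \<open>a\<close> is then a binomial series.\<close>

lemma sum_tail_class:
  assumes "i < k" "m0 \<in> multi_idx k"
  shows "(\<Sum>m\<in>tail_class k i m0 N. \<Prod>j=1..i. ext_binom (m j) (q_idx k l n m j))
    = (fps_X ^ weight {i<..k} m0 * Q_factor n i (q_idx k l n m0 i) (q_idx k l n m0 (Suc i))) $ N"
  using assms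
proof (induction i arbitrary: m0)
  case 0
  have "m = m0" if "m \<in> multi_idx k" "\<forall>j\<in>{0<..k}. m j = m0 j" for m
    using that "0.prems" unfolding multi_idx_def by (intro PiE_ext) auto
  then have "tail_class k 0 m0 N = (if weight {1..k} m0 = N then {m0} else {})"
    using "0.prems" by (auto simp: tail_class_def)
  moreover have "{0<..k} = {1..k}"
    by auto
  ultimately show ?case
    by simp
next
  case (Suc i)
  define p p' y where "p = q_idx k l n m0 (Suc i)" and "p' = q_idx k l n m0 (Suc (Suc i))"
    and "y = fps_X ^ Suc i * cheb (Suc i) powi (- 2)"
  define w where "w = weight {Suc i<..k} m0"
  obtain W where W:
    "\<And>a. fps_X ^ (Suc i * a) * Q_factor n i (2 * p - p' + 2 * int a - int (n (Suc i))) p = W * y ^ a"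
    "Q_factor n (Suc i) p p' = W * (1 - y) powi (- p - 1)"
    unfolding y_def using Q_factor_Suc by blast
  let ?f = "\<lambda>i m. \<Prod>j=1..i. ext_binom (m j) (q_idx k l n m j)"
  let ?g = "\<lambda>m. m (Suc i)"
  have slice: "(\<Sum>m | m \<in> tail_class k (Suc i) m0 N \<and> m (Suc i) = a. ?f (Suc i) m)
      = ext_binom a p * (fps_X ^ w * W * y ^ a) $ N" for a
  proof -
    let ?m = "m0(Suc i := a)"
    have m: "?m \<in> multi_idx k"
      using Suc.prems by (auto simp: multi_idx_def PiE_iff extensional_def)
    have qs: "q_idx k l n ?m (Suc i) = p" "q_idx k l n ?m (Suc (Suc i)) = p'"
      unfolding p_def p'_def by (auto intro!: q_idx_cong)
    have q: "q_idx k l n ?m i = 2 * p - p' + 2 * int a - int (n (Suc i))"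
      using q_idx_second_difference[of i k l n ?m] Suc.prems(1) qs by simp
    have "{i<..k} = insert (Suc i) {Suc i<..k}"
      using Suc.prems by auto
    then have wt: "weight {i<..k} ?m = w + Suc i * a"
      by (simp add: weight_def w_def)
    have "?f (Suc i) m = ext_binom a p * ?f i m" if "m \<in> tail_class k i ?m N" for m
    proof -
      have "m (Suc i) = a" "q_idx k l n m (Suc i) = q_idx k l n m0 (Suc i)"
        using that Suc.prems by (auto simp: tail_class_def intro!: q_idx_cong)
      then show ?thesis
        by (simp add: p_def)
    qed
    moreover have "{m. m \<in> tail_class k (Suc i) m0 N \<and> m (Suc i) = a} = tail_class k i ?m N"
      using tail_class_Suc_slice[of i k m0 N a] Suc.prems by simp
    ultimately have "(\<Sum>m | m \<in> tail_class k (Suc i) m0 N \<and> m (Suc i) = a. ?f (Suc i) m)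
        = ext_binom a p * (\<Sum>m\<in>tail_class k i ?m N. ?f i m)"
      unfolding sum_distrib_left by (intro sum.cong) auto
    also have "(\<Sum>m\<in>tail_class k i ?m N. ?f i m)
        = (fps_X ^ (w + Suc i * a) * Q_factor n i (2 * p - p' + 2 * int a - int (n (Suc i))) p) $ N"
      using Suc.IH[of ?m] Suc.prems m by (simp only: wt q qs Suc_lessD)
    also have "fps_X ^ (w + Suc i * a) * Q_factor n i (2 * p - p' + 2 * int a - int (n (Suc i))) p
        = fps_X ^ w * W * y ^ a"
      using W(1)[of a] by (simp only: power_add mult.assoc)
    finally show ?thesis .
  qed
  have "?g ` tail_class k (Suc i) m0 N \<subseteq> {..N}"
  proof clarsimp
    fix m
    assume m: "m \<in> tail_class k (Suc i) m0 N"
    have "m (Suc i) \<le> Suc i * m (Suc i)"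
      by simp
    also have "\<dots> \<le> weight {1..k} m"
      unfolding weight_def using Suc.prems by (intro member_le_sum[where i = "Suc i"]) auto
    finally show "m (Suc i) \<le> N"
      using m by (simp add: tail_class_def)
  qed
  then have "(\<Sum>m\<in>tail_class k (Suc i) m0 N. ?f (Suc i) m)
      = (\<Sum>a\<le>N. \<Sum>m | m \<in> tail_class k (Suc i) m0 N \<and> m (Suc i) = a. ?f (Suc i) m)"
    by (intro sum.group[symmetric] finite_tail_class) auto
  also have "\<dots> = (fps_X ^ w * W * (1 - y) powi (- p - 1)) $ N"
    unfolding slice by (rule sum_ext_binom_power) (simp add: y_def)
  also have "\<dots> = (fps_X ^ w * Q_factor n (Suc i) p p') $ N"
    by (simp only: W(2) mult.assoc)
  finally show ?case
    by (simp only: w_def p_def p'_def)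
qed

lemma q_tot_eq: "q_tot k l n m = int l + 2 * int (weight {1..k} m) - int (weight {1..k} n)"
  by (simp add: q_tot_def weight_def sum_subtractf sum_distrib_left algebra_simps)

text \<open>The degree bound for \<open>Q_factor\<close> equals
  \<open>2 * weight {1..i} m0 - q_tot k l n m0 - 1\<close>, while the sum is the coefficient at
  \<open>weight {1..i} m0\<close>. The -1, from -(i + 1) + i, covers the case q = 0.\<close>

lemma sum_tail_class_eq_0:
  assumes i: "i < k" and m0: "m0 \<in> multi_idx k"
    and q: "q_tot k l n m0 \<ge> 0" "q_idx k l n m0 i < 0" "q_idx k l n m0 (Suc i) \<ge> 0"
  shows "(\<Sum>m\<in>tail_class k i m0 (weight {1..k} m0).
    \<Prod>j=1..i. ext_binom (m j) (q_idx k l n m j)) = 0"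
proof -
  let ?p = "q_idx k l n m0 i" and ?p' = "q_idx k l n m0 (Suc i)"
  have split: "weight {1..k} m = weight {1..i} m + weight {i<..k} m" for m
  proof -
    have "{1..k} = {1..i} \<union> {i<..k}"
      using i by auto
    then show ?thesis
      by (simp add: weight_def sum.union_disjoint Int_def)
  qed
  have "int (Suc i) * ?p - int i * ?p' = int l + 2 * int (weight {i<..k} m0) - int (weight {i<..k} n)"
    using q_idx_linear[of i k l n m0]
    by (simp add: weight_def sum_subtractf sum_distrib_left algebra_simps)
  moreover have "(\<Sum>j=1..i. int (n j) * int j) = int (weight {1..i} n)"
    by (simp add: weight_def mult.commute)
  ultimately have "(- ?p - 1) * int (Suc i) + (?p' + 1) * int i + (\<Sum>j=1..i. int (n j) * int j)
      < 2 * int (weight {1..i} m0)"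
    using q(1) unfolding q_tot_eq split by (simp add: algebra_simps)
  moreover have "fps_deg_le (Q_factor n i ?p ?p')
    ((- ?p - 1) * int (Suc i) + (?p' + 1) * int i + (\<Sum>j=1..i. int (n j) * int j))"
    using q by (intro Q_factor_deg_le) auto
  ultimately have "Q_factor n i ?p ?p' $ weight {1..i} m0 = 0"
    unfolding fps_deg_le_def by blast
  then show ?thesis
    unfolding sum_tail_class[OF i m0] split[of m0] by (simp add: fps_X_power_mult_nth)
qed

section \<open>Splitting by the largest index with negative exponent\<close>

lemma sum_restrict_eq:
  fixes k l :: nat and n :: "nat \<Rightarrow> nat"
  defines "f \<equiv> \<lambda>m. \<Prod>j=1..k. ext_binom (m j) (q_idx k l n m j)"
  assumes "N \<ge> 0"
  shows "(\<Sum>m | m \<in> multi_idx k \<and> (\<forall>i\<in>{1..k}. q_idx k l n m i \<ge> 0) \<and> q_tot k l n m = N. f m)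
    = (\<Sum>m | m \<in> multi_idx k \<and> q_tot k l n m = N. f m)"
proof -
  define T where "T = {m \<in> multi_idx k. q_tot k l n m = N}"
  define Bad where "Bad = {m \<in> T. \<exists>i\<in>{1..k}. q_idx k l n m i < 0}"
  define top where "top m = Max {i \<in> {1..k}. q_idx k l n m i < 0}" for m
  \<comment> \<open>\<open>restrict\<close> forgets the entries up to \<open>top m\<close>, so a
    value of \<open>g\<close> is a top index with a tail.\<close>
  define g where "g m = (top m, restrict m {top m<..k})" for m
  have fin: "finite T"
    unfolding T_def by (rule finite_q_fibre)
  have top_eq: "top m = i"
    if "i \<in> {1..k}" "q_idx k l n m i < 0" "\<forall>j\<in>{i<..k}. q_idx k l n m j \<ge> 0" for m i
    unfolding top_def
  proof (intro Max_eqI)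
    fix j
    assume j: "j \<in> {i \<in> {1..k}. q_idx k l n m i < 0}"
    then have "j \<notin> {i<..k}"
      using that(3) by (metis (no_types, lifting) mem_Collect_eq not_less)
    then show "j \<le> i"
      using j by simp
  qed (use that in auto)
  have "(\<Sum>m | m \<in> Bad \<and> g m = z. f m) = 0" if z: "z \<in> g ` Bad" for z
  proof -
    obtain m0 where m0: "m0 \<in> Bad" "z = g m0"
      using z by blast
    define i where "i = top m0"
    have "i \<in> {i \<in> {1..k}. q_idx k l n m0 i < 0}"
      unfolding i_def top_def using m0 by (intro Max_in) (auto simp: Bad_def)
    then have i: "i \<in> {1..k}" "q_idx k l n m0 i < 0"
      by auto
    have above: "q_idx k l n m0 j \<ge> 0" if "j \<in> {i<..k}" for j
    proof (rule ccontr)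
      assume "\<not> q_idx k l n m0 j \<ge> 0"
      then have "j \<le> top m0"
        unfolding top_def using that by (intro Max_ge) auto
      then show False
        using that by (simp add: i_def)
    qed
    have "i < k"
      using i by (cases "i = k") auto
    have same_q: "q_idx k l n m j = q_idx k l n m0 j"
      if "\<forall>j\<in>{i<..k}. m j = m0 j" "j \<ge> i" for m j
      using that by (intro q_idx_cong) auto
    \<comment> \<open>Every q_j with \<open>j \<ge> i\<close> depends on the tail alone, so the
      whole tail class is bad with the same top index.\<close>
    have fibre: "{m. m \<in> Bad \<and> g m = z} = tail_class k i m0 (weight {1..k} m0)"
    proof (intro equalityI subsetI)
      fix m
      assume m: "m \<in> {m. m \<in> Bad \<and> g m = z}"
      then have "top m = i" and "restrict m {i<..k} = restrict m0 {i<..k}"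
        by (auto simp: m0(2) g_def i_def)
      then have "\<forall>j\<in>{i<..k}. m j = m0 j"
        by (metis restrict_apply')
      then show "m \<in> tail_class k i m0 (weight {1..k} m0)"
        using m m0(1) by (auto simp: tail_class_def Bad_def T_def q_tot_eq)
    next
      fix m
      assume m: "m \<in> tail_class k i m0 (weight {1..k} m0)"
      then have eq: "\<forall>j\<in>{i<..k}. m j = m0 j"
        by (simp add: tail_class_def)
      have "top m = i"
        using i above same_q[OF eq] by (intro top_eq) auto
      moreover have "restrict m {i<..k} = restrict m0 {i<..k}"
        using eq by auto
      ultimately have "g m = z"
        by (simp add: m0(2) g_def i_def)
      moreover have "q_idx k l n m i < 0"
        using i(2) same_q[OF eq] by simp
      then have "m \<in> Bad"
        using m m0(1) i(1) unfolding tail_class_def Bad_def T_def q_tot_eq by auto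
      ultimately show "m \<in> {m. m \<in> Bad \<and> g m = z}"
        by simp
    qed
    \<comment> \<open>The factors beyond \<open>i\<close> are constant on the class and come out of
      the sum.\<close>
    have "f m = (\<Prod>j=1..i. ext_binom (m j) (q_idx k l n m j))
        * (\<Prod>j\<in>{i<..k}. ext_binom (m0 j) (q_idx k l n m0 j))"
      if "m \<in> tail_class k i m0 (weight {1..k} m0)" for m
    proof -
      have eq: "\<forall>j\<in>{i<..k}. m j = m0 j"
        using that by (simp add: tail_class_def)
      have "{1..k} = {1..i} \<union> {i<..k}"
        using i by auto
      then have "f m = (\<Prod>j=1..i. ext_binom (m j) (q_idx k l n m j))
        * (\<Prod>j\<in>{i<..k}. ext_binom (m j) (q_idx k l n m j))"
        unfolding f_def by (simp add: prod.union_disjoint Int_def)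
      also have "(\<Prod>j\<in>{i<..k}. ext_binom (m j) (q_idx k l n m j))
          = (\<Prod>j\<in>{i<..k}. ext_binom (m0 j) (q_idx k l n m0 j))"
        using eq same_q[OF eq] by (intro prod.cong) auto
      finally show ?thesis .
    qed
    then have "(\<Sum>m | m \<in> Bad \<and> g m = z. f m)
        = (\<Sum>m\<in>tail_class k i m0 (weight {1..k} m0). \<Prod>j=1..i. ext_binom (m j) (q_idx k l n m j))
          * (\<Prod>j\<in>{i<..k}. ext_binom (m0 j) (q_idx k l n m0 j))"
      unfolding fibre by (simp add: sum_distrib_right cong: sum.cong)
    also have "\<dots> = 0"
      using sum_tail_class_eq_0[OF \<open>i < k\<close>, of m0 l n] m0 i above[of "Suc i"] \<open>i < k\<close> \<open>N \<ge> 0\<close>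
      by (simp add: Bad_def T_def)
    finally show ?thesis .
  qed
  then have "sum f Bad = 0"
    using fin by (subst sum.image_gen[where g = g]) (auto simp: Bad_def)
  moreover have "sum f T = sum f (T - Bad) + sum f Bad"
    using fin by (intro sum.subset_diff) (auto simp: Bad_def)
  moreover have "T - Bad = {m. m \<in> multi_idx k \<and> (\<forall>i\<in>{1..k}. q_idx k l n m i \<ge> 0) \<and> q_tot k l n m = N}"
    by (auto simp: Bad_def T_def not_less)
  ultimately show ?thesis
    by (simp add: T_def)
qed

section \<open>Evaluation at one\<close>

lemma eval_lpoly_one: "eval_lpoly (\<lambda>_. 1) p = (\<Sum>e\<in>Poly_Mapping.keys p. Poly_Mapping.lookup p e)"
  by (simp add: eval_lpoly_def)

text \<open>Keys may cancel in \<open>p + q\<close>, so all three sums are taken over the union of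
  the keys.\<close>

lemma eval_lpoly_one_add:
  "eval_lpoly (\<lambda>_. 1) (p + q) = eval_lpoly (\<lambda>_. 1) p + eval_lpoly (\<lambda>_. 1) q"
proof -
  let ?K = "Poly_Mapping.keys p \<union> Poly_Mapping.keys q"
  have "eval_lpoly (\<lambda>_. 1) r = (\<Sum>e\<in>?K. Poly_Mapping.lookup r e)"
    if "Poly_Mapping.keys r \<subseteq> ?K" for r
    unfolding eval_lpoly_one using that by (intro sum.mono_neutral_left) (auto simp: in_keys_iff)
  then show ?thesis
    by (simp add: Poly_Mapping.keys_add lookup_add sum.distrib)
qed

lemma eval_lpoly_one_sum: "eval_lpoly (\<lambda>_. 1) (sum f A) = (\<Sum>x\<in>A. eval_lpoly (\<lambda>_. 1) (f x))"
  by (induction A rule: infinite_finite_induct)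
    (simp_all add: eval_lpoly_one_add, simp_all add: eval_lpoly_one)

lemma prod_single:
  "(\<Prod>i\<in>A. Poly_Mapping.single (g i) (c i))
    = Poly_Mapping.single (\<Sum>i\<in>A. g i :: 'b::comm_monoid_add) (\<Prod>i\<in>A. c i :: 'c::comm_semiring_1)"
  by (induction A rule: infinite_finite_induct) (simp_all add: mult_single)

text \<open>\<open>Z_term\<close> is a single monomial; if its coefficient is 0, it has no keys and
  both sides are 0.\<close>

lemma eval_lpoly_one_Z_term:
  "eval_lpoly (\<lambda>_. 1) (Z_term k l n m) = (\<Prod>j=1..k. ext_binom (m j) (q_idx k l n m j))"
  by (simp add: Z_term_def var_monom_def prod_single eval_lpoly_one)

theorem theorem3p10:
  fixes k l :: nat and n :: "nat \<Rightarrow> nat"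
  assumes "k \<ge> 1"
  shows "fls_regpart (eval_fls (\<lambda>_. 1) (Z_restr k l n)) = fls_regpart (eval_fls (\<lambda>_. 1) (Z_full k l n))"
proof (rule fps_ext)
  fix N
  show "fls_regpart (eval_fls (\<lambda>_. 1) (Z_restr k l n)) $ N
      = fls_regpart (eval_fls (\<lambda>_. 1) (Z_full k l n)) $ N"
    using sum_restrict_eq[of "int N" k l n]
    by (simp add: Z_restr_def Z_full_def eval_fls_nth Z_series_nth eval_lpoly_one_sum
        eval_lpoly_one_Z_term conj_assoc)
qed

end
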